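(* Let $\Theta=(\Sigma,\mathit{sim},\mathit{ser})$ be a comtrace alphabet with $|\Sigma|=k$. Given two step sequences over $\Theta$ containing $O(n)$ action occurrences in total, whether they are comtrace equivalent ($w\equiv_\Theta u$) can be decided in time $O(nk)$.
   Context: A comtrace alphabet is $\Theta=(\Sigma,\mathit{sim},\mathit{ser})$ with $\Sigma$ finite nonempty, $\mathit{ser}\subseteq\mathit{sim}\subseteq\Sigma\times\Sigma$, $\mathit{sim}$ irreflexive and symmetric. Steps: nonempty $A\subseteq\Sigma$ with $(a,b)\in\mathit{sim}$ for distinct $a,b\in A$; step sequences are finite sequences of steps. The comtrace congruence $\equiv_\Theta$ is the reflexive, symmetric, transitive closure of the relation $uABz\sim_\Theta u(A\cup B)z$ for steps $A,B$ with $A\times B\subseteq\mathit{ser}$. *)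

theory Defs
  imports Main
begin

section \<open>Comtraces\<close>

definition comtrace_alphabet ::
    "'a set \<Rightarrow> ('a \<times> 'a) set \<Rightarrow> ('a \<times> 'a) set \<Rightarrow> bool" where
  "comtrace_alphabet \<Sigma> sim ser \<longleftrightarrow>
     finite \<Sigma> \<and> \<Sigma> \<noteq> {} \<and> ser \<subseteq> sim \<and> sim \<subseteq> \<Sigma> \<times> \<Sigma> \<and> irrefl sim \<and> sym sim"

definition steps :: "'a set \<Rightarrow> ('a \<times> 'a) set \<Rightarrow> 'a set set" where
  "steps \<Sigma> sim =
     {A. A \<noteq> {} \<and> A \<subseteq> \<Sigma> \<and> (\<forall>a\<in>A. \<forall>b\<in>A. a \<noteq> b \<longrightarrow> (a, b) \<in> sim)}"

definition step_sequences :: "'a set \<Rightarrow> ('a \<times> 'a) set \<Rightarrow> 'a set list set" where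
  "step_sequences \<Sigma> sim = lists (steps \<Sigma> sim)"

inductive comtrace_merge ::
    "'a set \<Rightarrow> ('a \<times> 'a) set \<Rightarrow> ('a \<times> 'a) set \<Rightarrow> 'a set list \<Rightarrow> 'a set list \<Rightarrow> bool"
  for \<Sigma> sim ser where
  "\<lbrakk>u \<in> step_sequences \<Sigma> sim; z \<in> step_sequences \<Sigma> sim;
    A \<in> steps \<Sigma> sim; B \<in> steps \<Sigma> sim; A \<times> B \<subseteq> ser\<rbrakk>
   \<Longrightarrow> comtrace_merge \<Sigma> sim ser (u @ [A, B] @ z) (u @ [A \<union> B] @ z)"

definition comtrace_equiv ::
    "'a set \<Rightarrow> ('a \<times> 'a) set \<Rightarrow> ('a \<times> 'a) set \<Rightarrow> 'a set list \<Rightarrow> 'a set list \<Rightarrow> bool" where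
  "comtrace_equiv \<Sigma> sim ser = equivclp (comtrace_merge \<Sigma> sim ser)"

definition occurrences :: "'a set list \<Rightarrow> nat" where
  "occurrences w = (\<Sum>A\<leftarrow>w. card A)"


section \<open>Machine model\<close>

text \<open>
  Structured programs for a random access machine over the natural numbers under the uniform
  cost criterion. A program uses finitely many scalar registers and finitely many
  randomly accessible arrays. The arithmetic consists of addition and truncated subtraction only;
  in particular there is no unit-cost multiplication. Every constant, register access, array
  access, operator, assignment and test costs one time unit.
\<close>

datatype aexp =
    Const nat
  | Var nat
  | Read nat aexp
  | Plus aexp aexp
  | Minus aexp aexp

datatype bexp =
    Less aexp aexp
  | Equal aexp aexp
  | Neg bexp
  | Conj bexp bexp

datatype com =
    Skip
  | Assign nat aexp
  | Write nat aexp aexp  \<comment> \<open>array, index, value\<close>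
  | Seq com com
  | Cond bexp com com
  | While bexp com

record state =
  regs :: "nat \<Rightarrow> nat"
  arrs :: "nat \<Rightarrow> nat \<Rightarrow> nat"

primrec aval :: "aexp \<Rightarrow> state \<Rightarrow> nat" where
  "aval (Const m) s = m"
| "aval (Var x) s = regs s x"
| "aval (Read a e) s = arrs s a (aval e s)"
| "aval (Plus e f) s = aval e s + aval f s"
| "aval (Minus e f) s = aval e s - aval f s"

primrec acost :: "aexp \<Rightarrow> nat" where
  "acost (Const m) = 1"
| "acost (Var x) = 1"
| "acost (Read a e) = 1 + acost e"
| "acost (Plus e f) = 1 + acost e + acost f"
| "acost (Minus e f) = 1 + acost e + acost f"

primrec bval :: "bexp \<Rightarrow> state \<Rightarrow> bool" where
  "bval (Less e f) s \<longleftrightarrow> aval e s < aval f s"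
| "bval (Equal e f) s \<longleftrightarrow> aval e s = aval f s"
| "bval (Neg b) s \<longleftrightarrow> \<not> bval b s"
| "bval (Conj b d) s \<longleftrightarrow> bval b s \<and> bval d s"

primrec bcost :: "bexp \<Rightarrow> nat" where
  "bcost (Less e f) = 1 + acost e + acost f"
| "bcost (Equal e f) = 1 + acost e + acost f"
| "bcost (Neg b) = 1 + bcost b"
| "bcost (Conj b d) = 1 + bcost b + bcost d"

text \<open>\<open>exec c s t s'\<close>: started in \<open>s\<close>, the program \<open>c\<close> halts in \<open>s'\<close> after exactly \<open>t\<close> time units.\<close>

inductive exec :: "com \<Rightarrow> state \<Rightarrow> nat \<Rightarrow> state \<Rightarrow> bool" where
  Skip: "exec Skip s 1 s"
| Assign: "exec (Assign x e) s (1 + acost e) (s\<lparr>regs := (regs s)(x := aval e s)\<rparr>)"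
| Write: "exec (Write a e f) s (1 + acost e + acost f)
            (s\<lparr>arrs := (arrs s)(a := (arrs s a)(aval e s := aval f s))\<rparr>)"
| Seq: "\<lbrakk>exec c s t1 s1; exec d s1 t2 s2\<rbrakk> \<Longrightarrow> exec (Seq c d) s (t1 + t2) s2"
| CondTrue: "\<lbrakk>bval b s; exec c s t s1\<rbrakk> \<Longrightarrow> exec (Cond b c d) s (1 + bcost b + t) s1"
| CondFalse: "\<lbrakk>\<not> bval b s; exec d s t s1\<rbrakk> \<Longrightarrow> exec (Cond b c d) s (1 + bcost b + t) s1"
| WhileFalse: "\<not> bval b s \<Longrightarrow> exec (While b c) s (1 + bcost b) s"
| WhileTrue: "\<lbrakk>bval b s; exec c s t1 s1; exec (While b c) s1 t2 s2\<rbrakk>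
     \<Longrightarrow> exec (While b c) s (1 + bcost b + t1 + t2) s2"

lemma exec_deterministic:
  "exec c s t s' \<Longrightarrow> exec c s u s'' \<Longrightarrow> t = u \<and> s' = s''"
proof (induction arbitrary: u s'' rule: exec.induct)
  case (Seq c s t1 s1 d t2 s2)
  from Seq.prems show ?case by cases (metis Seq.IH)
next
  case (CondTrue b s c t s1 d)
  from CondTrue.prems show ?case using CondTrue.hyps by cases (auto dest: CondTrue.IH)
next
  case (CondFalse b s d t s1 c)
  from CondFalse.prems show ?case using CondFalse.hyps by cases (auto dest: CondFalse.IH)
next
  case (WhileTrue b s c t1 s1 t2 s2)
  from WhileTrue.prems show ?case
    by cases (use WhileTrue.hyps in blast, metis WhileTrue.IH)
qed (auto elim: exec.cases)

text \<open>Halting with register 0 equal to 1 is acceptance, with register 0 equal to 0 rejection.\<close>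

definition decides_within :: "com \<Rightarrow> state \<Rightarrow> bool \<Rightarrow> nat \<Rightarrow> bool" where
  "decides_within P s answer T \<longleftrightarrow>
     (\<exists>t s'. exec P s t s' \<and> t \<le> T \<and> regs s' 0 = of_bool answer)"


section \<open>Input representation\<close>

text \<open>
  The actions are presented to the machine as the numbers \<open>0, \<dots>, k - 1\<close> via a bijection \<open>num\<close>.
  A step is written as its size followed by its actions in an arbitrary order, and a step
  sequence as the concatenation of its steps.
\<close>

definition encodes_step :: "('a \<Rightarrow> nat) \<Rightarrow> nat list \<Rightarrow> 'a set \<Rightarrow> bool" where
  "encodes_step num xs A \<longleftrightarrow> distinct xs \<and> set xs = num ` A"

definition encodes :: "('a \<Rightarrow> nat) \<Rightarrow> nat list \<Rightarrow> 'a set list \<Rightarrow> bool" where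
  "encodes num x w \<longleftrightarrow>
     (\<exists>xss. list_all2 (encodes_step num) xss w \<and> x = concat (map (\<lambda>xs. length xs # xs) xss))"

text \<open>Row-major adjacency matrix of a relation on \<open>{..<k}\<close>.\<close>

definition matrix :: "nat \<Rightarrow> (nat \<times> nat) set \<Rightarrow> nat list" where
  "matrix k r = map (\<lambda>i. of_bool ((i div k, i mod k) \<in> r)) [0..<k * k]"

definition array_of :: "nat list \<Rightarrow> nat \<Rightarrow> nat" where
  "array_of xs i = (if i < length xs then xs ! i else 0)"

definition input_state ::
    "('a \<Rightarrow> nat) \<Rightarrow> nat \<Rightarrow> ('a \<times> 'a) set \<Rightarrow> ('a \<times> 'a) set \<Rightarrow> nat list \<Rightarrow> nat list \<Rightarrow> state" where
  "input_state num k sim ser x y =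
     \<lparr>regs = (\<lambda>_. 0)(0 := k, 1 := length x, 2 := length y),
      arrs = (\<lambda>_ _. 0)(0 := array_of (matrix k (map_prod num num ` sim)),
                       1 := array_of (matrix k (map_prod num num ` ser)),
                       2 := array_of x,
                       3 := array_of y)\<rparr>"

end

theory Submission
  imports Defs
begin

text \<open>
  For actions \<open>a\<close>, \<open>b\<close> the profile of a step sequence lists, for each occurrence of \<open>a\<close>, how many
  \<open>b\<close>'s lie in strictly earlier steps. For \<open>(b, a) \<notin> ser\<close> the profile is invariant under the
  congruence. Conversely, if the profiles of \<open>A # w\<close> and \<open>u\<close> agree for all such pairs, then they allow
  the first occurrences of the actions of \<open>A\<close> to be moved to the front of \<open>u\<close> and merged there into
  one step, so that induction shows \<open>A # w\<close> and \<open>u\<close> to be equivalent. The machine tabulates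
  the profiles of the first sequence, \<open>k\<close> entries per action occurrence, and compares them with those
  of the second.
\<close>

section \<open>Profiles characterise comtrace equivalence\<close>

definition occs :: "'a \<Rightarrow> 'a set list \<Rightarrow> nat" where
  "occs a w = length (filter (\<lambda>A. a \<in> A) w)"

lemma occs_simps [simp]:
  "occs a [] = 0"
  "occs a (A # w) = of_bool (a \<in> A) + occs a w"
  "occs a (v @ w) = occs a v + occs a w"
  by (simp_all add: occs_def)

text \<open>The accumulator \<open>n\<close> is the number of \<open>b\<close>'s in the steps
  already passed. It is emitted before the current step is counted, so a \<open>b\<close> in the
  same step as \<open>a\<close> does not contribute.\<close>

primrec profile :: "'a \<Rightarrow> 'a \<Rightarrow> 'a set list \<Rightarrow> nat \<Rightarrow> nat list" where
  "profile a b [] n = []"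
| "profile a b (A # w) n =
     (if a \<in> A then [n] else []) @ profile a b w (n + of_bool (b \<in> A))"

lemma length_profile [simp]: "length (profile a b w n) = occs a w"
  by (induction w arbitrary: n) auto

lemma profile_append:
  "profile a b (v @ w) n = profile a b v n @ profile a b w (n + occs b v)"
  by (induction v arbitrary: n) (auto simp: add.assoc)

lemma profile_shift: "profile a b w n = map (\<lambda>i. i + n) (profile a b w 0)"
proof (induction w arbitrary: n)
  case (Cons A w)
  show ?case by (subst (1 2) profile.simps, subst (1 2) Cons.IH) simp
qed simp

text \<open>A starting count adds one constant to every entry, which is injective. This is what
  allows a common first step to be cancelled.\<close>

lemma profile_eq_shift:
  "profile a b v n = profile a b w n \<longleftrightarrow> profile a b v 0 = profile a b w 0"
proof -
  have "inj (\<lambda>i::nat. i + n)" by (simp add: inj_def)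
  then show ?thesis
    by (subst (1 2) profile_shift) (metis inj_map_eq_map)
qed

lemma profile_image:
  assumes "inj_on f \<Sigma>" "a \<in> \<Sigma>" "b \<in> \<Sigma>" "\<forall>A\<in>set w. A \<subseteq> \<Sigma>"
  shows "profile (f a) (f b) (map ((`) f) w) n = profile a b w n"
  using assms(4)
proof (induction w arbitrary: n)
  case (Cons A w)
  then have "f a \<in> f ` A \<longleftrightarrow> a \<in> A" "f b \<in> f ` A \<longleftrightarrow> b \<in> A"
    using assms(1-3) by (auto simp: inj_on_def)
  with Cons show ?case by simp
qed simp

text \<open>Merging two steps can turn a \<open>b\<close> strictly before \<open>a\<close> into a
  \<open>b\<close> simultaneous with \<open>a\<close> only if \<open>(b, a) \<in> ser\<close>;
  exactly these pairs are exempted.\<close>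

definition same_profiles ::
    "'a set \<Rightarrow> ('a \<times> 'a) set \<Rightarrow> 'a set list \<Rightarrow> 'a set list \<Rightarrow> bool" where
  "same_profiles \<Sigma> ser w u \<longleftrightarrow>
     (\<forall>a\<in>\<Sigma>. \<forall>b\<in>\<Sigma>. (b, a) \<notin> ser \<longrightarrow> profile a b w 0 = profile a b u 0)"

lemma same_profiles_equivp: "equivp (same_profiles \<Sigma> ser)"
  by (rule equivpI) (auto simp: reflp_def symp_def transp_def same_profiles_def)

lemma same_profiles_ConsD:
  "same_profiles \<Sigma> ser (A # w) (A # u) \<Longrightarrow> same_profiles \<Sigma> ser w u"
  unfolding same_profiles_def profile.simps append_same_eq same_append_eq
    profile_eq_shift[of _ _ w "0 + _"] .

section \<open>First occurrences read off from profiles\<close>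

definition strictly_before :: "'a \<Rightarrow> 'a set list \<Rightarrow> 'a \<Rightarrow> nat" where
  "strictly_before b u a = occs b (takeWhile (\<lambda>B. a \<notin> B) u)"

primrec up_to_first :: "'a \<Rightarrow> 'a set list \<Rightarrow> 'a \<Rightarrow> nat" where
  "up_to_first b [] a = 0"
| "up_to_first b (B # u) a = of_bool (b \<in> B) + (if a \<in> B then 0 else up_to_first b u a)"

lemma hd_profile: "0 < occs a u \<Longrightarrow> hd (profile a b u n) = n + strictly_before b u a"
  by (induction u arbitrary: n) (auto simp: strictly_before_def)

lemma zeros_profile_pos: "0 < n \<Longrightarrow> count_list (profile b a u n) 0 = 0"
  by (induction u arbitrary: n) auto

text \<open>A \<open>b\<close> has entry 0 exactly when no \<open>a\<close> lies in a strictly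
  earlier step, that is, when it comes no later than the step of the first \<open>a\<close>.\<close>

lemma zeros_profile: "count_list (profile b a u 0) 0 = up_to_first b u a"
  by (induction u) (auto simp: zeros_profile_pos)

section \<open>Invariance of profiles under the congruence\<close>

locale comtrace =
  fixes \<Sigma> :: "'a set" and sim ser :: "('a \<times> 'a) set"
  assumes alphabet: "comtrace_alphabet \<Sigma> sim ser"
begin

abbreviation equiv (infix "\<approx>" 50) where "w \<approx> u \<equiv> comtrace_equiv \<Sigma> sim ser w u"

lemma ser_sim: "(a, b) \<in> ser \<Longrightarrow> (a, b) \<in> sim \<and> (b, a) \<in> sim \<and> a \<noteq> b"
  using alphabet by (auto simp: comtrace_alphabet_def irrefl_def dest: symD)

lemma equiv_refl [simp]: "w \<approx> w"
  by (simp add: comtrace_equiv_def)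

lemma equiv_sym: "w \<approx> u \<Longrightarrow> u \<approx> w"
  by (simp add: comtrace_equiv_def equivclp_sym)

lemma equiv_trans [trans]: "w \<approx> u \<Longrightarrow> u \<approx> v \<Longrightarrow> w \<approx> v"
  unfolding comtrace_equiv_def by (rule equivclp_trans)

lemma merge_Cons:
  assumes "comtrace_merge \<Sigma> sim ser v w" "A \<in> steps \<Sigma> sim"
  shows "comtrace_merge \<Sigma> sim ser (A # v) (A # w)"
  using assms(1)
proof cases
  case (1 u z B D)
  with assms(2) have "A # u \<in> step_sequences \<Sigma> sim" by (simp add: step_sequences_def)
  from comtrace_merge.intros[OF this 1(4-7)] 1(1,2) show ?thesis by simp
qed

lemma equiv_Cons:
  assumes "v \<approx> w" "A \<in> steps \<Sigma> sim" shows "A # v \<approx> A # w"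
  using assms(1) unfolding comtrace_equiv_def
proof (induction rule: equivclp_induct)
  case (step y z)
  have "equivclp (comtrace_merge \<Sigma> sim ser) (A # y) (A # z)"
    using step(2) assms(2) by (metis merge_Cons r_into_equivclp equivclp_sym)
  with step(3) show ?case by (rule equivclp_trans)
qed simp

text \<open>Since \<open>ser\<close> is irreflexive, \<open>A\<close> and \<open>B\<close> are
  disjoint, so merging loses no occurrence and the counts passed on to \<open>z\<close> agree.
  Inside the block, only an \<open>a\<close> in \<open>B\<close> with a \<open>b\<close> in
  \<open>A\<close> sees a change, and then \<open>(b, a) \<in> ser\<close>.\<close>

lemma profile_merge:
  assumes "comtrace_merge \<Sigma> sim ser v w"
  shows "same_profiles \<Sigma> ser v w"
  using assms
proof cases
  case (1 u z A B)
  have "profile a b [A, B] n = profile a b [A \<union> B] n" if "(b, a) \<notin> ser" for a b n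
    using 1(7) ser_sim that by auto
  moreover have "occs b [A, B] = occs b [A \<union> B]" for b
    using 1(7) ser_sim by auto
  ultimately show ?thesis
    unfolding same_profiles_def 1(1,2) profile_append by (simp del: profile.simps occs_simps)
qed

lemma profile_equiv: "w \<approx> u \<Longrightarrow> same_profiles \<Sigma> ser w u"
  unfolding comtrace_equiv_def
proof (induction rule: equivclp_induct)
  case base
  show ?case by (simp add: same_profiles_def)
next
  case (step y z)
  then show ?case
    by (metis profile_merge same_profiles_equivp equivp_symp equivp_transp)
qed

section \<open>Moving a step to the front\<close>

definition opt_Cons :: "'a set \<Rightarrow> 'a set list \<Rightarrow> 'a set list" (infixr "\<cdot>" 65) where
  "A \<cdot> w = (if A = {} then w else A # w)"

text \<open>The empty set is no step, but the intersections and differences of steps that arise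
  below may be empty. Admitting it, with \<open>\<cdot>\<close> dropping it, avoids case
  distinctions.\<close>

definition opt_step :: "'a set \<Rightarrow> bool" where
  "opt_step A \<longleftrightarrow> A = {} \<or> A \<in> steps \<Sigma> sim"

lemma opt_step_subset: "opt_step A \<Longrightarrow> B \<subseteq> A \<Longrightarrow> opt_step B"
  unfolding opt_step_def steps_def by blast

lemma opt_Cons_step_sequences:
  "opt_step A \<Longrightarrow> w \<in> step_sequences \<Sigma> sim \<Longrightarrow> A \<cdot> w \<in> step_sequences \<Sigma> sim"
  by (auto simp: opt_step_def opt_Cons_def step_sequences_def)

lemma equiv_opt_Cons: "v \<approx> w \<Longrightarrow> opt_step A \<Longrightarrow> A \<cdot> v \<approx> A \<cdot> w"
  by (auto simp: opt_step_def opt_Cons_def equiv_Cons)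

lemma opt_Cons_merge:
  assumes "opt_step A" "opt_step B" "A \<times> B \<subseteq> ser" "w \<in> step_sequences \<Sigma> sim"
  shows "A \<cdot> B \<cdot> w \<approx> (A \<union> B) \<cdot> w"
proof (cases "A = {} \<or> B = {}")
  case False
  have "[] \<in> step_sequences \<Sigma> sim" by (simp add: step_sequences_def)
  from comtrace_merge.intros[OF this assms(4) _ _ assms(3)] False assms(1,2) show ?thesis
    by (auto simp: opt_Cons_def opt_step_def comtrace_equiv_def r_into_equivclp)
qed (auto simp: opt_Cons_def)

text \<open>Both orders merge into the same step \<open>A \<union> B\<close>.\<close>

lemma opt_Cons_swap:
  assumes "opt_step A" "opt_step B" "A \<times> B \<subseteq> ser" "B \<times> A \<subseteq> ser" "w \<in> step_sequences \<Sigma> sim"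
  shows "A \<cdot> B \<cdot> w \<approx> B \<cdot> A \<cdot> w"
  using opt_Cons_merge[OF assms(1,2,3,5)] opt_Cons_merge[OF assms(2,1,4,5)]
  by (metis equiv_sym equiv_trans sup_commute)

text \<open>Conditions for gathering the first occurrences of the actions of \<open>A\<close> in one
  front step. Whatever lies strictly before such an \<open>a\<close> must be mergeable with it from
  the left. Whatever lies up to its step and is not extracted itself must be able to go behind it;
  the allowance \<open>of_bool (b \<in> A)\<close> is the one \<open>b\<close> that is extracted
  along with \<open>a\<close>.\<close>

definition extractable :: "'a set \<Rightarrow> 'a set list \<Rightarrow> bool" where
  "extractable A u \<longleftrightarrow> (\<forall>a\<in>A. 0 < occs a u \<and>
     (\<forall>b\<in>\<Sigma>. 0 < strictly_before b u a \<longrightarrow> (b, a) \<in> ser) \<and>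
     (\<forall>b\<in>\<Sigma>. of_bool (b \<in> A) < up_to_first b u a \<longrightarrow> (a, b) \<in> ser))"

text \<open>An \<open>a\<close> outside \<open>B\<close> has its first occurrence in the tail. If
  \<open>b \<in> A \<inter> B\<close>, then dropping \<open>B\<close> lowers the count of
  \<open>b\<close> and the allowance for \<open>b\<close> by one each; otherwise the allowance stays
  the same and the count does not grow.\<close>

lemma extractable_tl:
  assumes "extractable A (B # u)" shows "extractable (A - B) u"
  unfolding extractable_def
proof (intro ballI conjI impI)
  fix a assume a: "a \<in> A - B"
  show "0 < occs a u" using assms a by (auto simp: extractable_def)
  fix b assume b: "b \<in> \<Sigma>"
  show "(b, a) \<in> ser" if "0 < strictly_before b u a"
    using assms a b that by (auto simp: extractable_def strictly_before_def)
  show "(a, b) \<in> ser" if "of_bool (b \<in> A - B) < up_to_first b u a"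
  proof -
    have "of_bool (b \<in> A) < up_to_first b (B # u) a" using a that by auto
    then show ?thesis using assms a b unfolding extractable_def by blast
  qed
qed

text \<open>The part of \<open>A\<close> still missing from the head step \<open>B\<close> is first pulled to the front of the
  tail; it then commutes with \<open>B - A\<close> and merges with \<open>A \<inter> B\<close>.\<close>

lemma equiv_step_in_front:
  assumes "u \<in> step_sequences \<Sigma> sim" "opt_step A" "extractable A u"
  shows "\<exists>u'\<in>step_sequences \<Sigma> sim. u \<approx> A \<cdot> u'"
  using assms
proof (induction u arbitrary: A)
  case Nil
  then have "A = {}" by (auto simp: extractable_def)
  then show ?case using Nil(1) by (auto simp: opt_Cons_def intro!: bexI[of _ "[]"])
next
  case (Cons B u)
  let ?C = "A \<inter> B" and ?D = "B - A" and ?E = "A - B"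
  have B: "B \<in> steps \<Sigma> sim" and u: "u \<in> step_sequences \<Sigma> sim"
    using Cons.prems(1) by (auto simp: step_sequences_def)
  have "opt_step B" using B by (simp add: opt_step_def)
  with Cons.prems(2) have opt: "opt_step B" "opt_step ?C" "opt_step ?D" "opt_step ?E"
    by (auto elim: opt_step_subset)
  have \<Sigma>: "B \<subseteq> \<Sigma>" using B by (auto simp: steps_def)
  have ext: "0 < strictly_before b (B # u) a \<Longrightarrow> (b, a) \<in> ser"
    "of_bool (b \<in> A) < up_to_first b (B # u) a \<Longrightarrow> (a, b) \<in> ser" if "a \<in> A" "b \<in> B" for a b
    using Cons.prems(3) that \<Sigma> unfolding extractable_def by blast+
  \<comment> \<open>A \<open>b\<close> in \<open>B - A\<close> is counted by
    \<open>up_to_first\<close> at the head already, against the allowance 0. For \<open>BE\<close>,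
    an action of \<open>A - B\<close> first occurs after the head, so all of \<open>B\<close> lies
    strictly before it.\<close>
  have CD: "?C \<times> ?D \<subseteq> ser" and ED: "?E \<times> ?D \<subseteq> ser"
    using ext(2) by auto
  have BE: "B \<times> ?E \<subseteq> ser"
    using ext(1) by (auto simp: strictly_before_def)
  from Cons.IH[OF u opt(4) extractable_tl[OF Cons.prems(3)]]
  obtain u' where u': "u' \<in> step_sequences \<Sigma> sim" "u \<approx> ?E \<cdot> u'" by blast
  have "B # u = B \<cdot> u" using B by (auto simp: opt_Cons_def steps_def)
  also have "B \<cdot> u \<approx> B \<cdot> ?E \<cdot> u'"
    using u' opt by (intro equiv_opt_Cons)
  also have "B \<cdot> ?E \<cdot> u' \<approx> ?C \<cdot> ?D \<cdot> ?E \<cdot> u'"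
    using opt_Cons_merge[OF opt(2,3) CD opt_Cons_step_sequences[OF opt(4) u'(1)]]
    by (metis equiv_sym Int_commute Un_Diff_Int Un_commute)
  also have "?C \<cdot> ?D \<cdot> ?E \<cdot> u' \<approx> ?C \<cdot> ?E \<cdot> ?D \<cdot> u'"
    using opt u' BE ED by (intro equiv_opt_Cons opt_Cons_swap) auto
  also have "?C \<cdot> ?E \<cdot> ?D \<cdot> u' \<approx> (?C \<union> ?E) \<cdot> ?D \<cdot> u'"
    using opt u' BE by (intro opt_Cons_merge opt_Cons_step_sequences) auto
  also have "?C \<union> ?E = A" by blast
  finally show ?case using opt_Cons_step_sequences[OF opt(3) u'(1)] by blast
qed

lemma same_profiles_occs:
  "same_profiles \<Sigma> ser w u \<Longrightarrow> a \<in> \<Sigma> \<Longrightarrow> occs a w = occs a u"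
  \<comment> \<open>No pair \<open>(a, a)\<close> is in \<open>ser\<close>, so the profile of
    \<open>a\<close> against itself is among those compared, and its length is the number of
    \<open>a\<close>'s.\<close>
  unfolding same_profiles_def using ser_sim by (metis length_profile)

text \<open>In \<open>A # w\<close> nothing lies strictly before an \<open>a\<close> in
  \<open>A\<close>, and up to its step every \<open>b\<close> occurs
  \<open>of_bool (b \<in> A)\<close> times. The first number is the head of the profile of
  \<open>a\<close> against \<open>b\<close>, the second the number of zeros in that of
  \<open>b\<close> against \<open>a\<close>; so \<open>u\<close> can deviate only for pairs in
  \<open>ser\<close>.\<close>

lemma extractable_first_step:
  assumes "same_profiles \<Sigma> ser (A # w) u" "A \<subseteq> \<Sigma>"
  shows "extractable A u"
  unfolding extractable_def
proof (intro ballI conjI impI)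
  fix a assume a: "a \<in> A"
  then show pos: "0 < occs a u"
    using same_profiles_occs[OF assms(1), of a] assms(2) by auto
  fix b assume b: "b \<in> \<Sigma>"
  show "(b, a) \<in> ser" if "0 < strictly_before b u a"
  proof (rule ccontr)
    assume "(b, a) \<notin> ser"
    then have "hd (profile a b (A # w) 0) = hd (profile a b u 0)"
      using assms a b unfolding same_profiles_def by (metis subsetD)
    then show False using a that pos by (simp add: hd_profile)
  qed
  show "(a, b) \<in> ser" if less: "of_bool (b \<in> A) < up_to_first b u a"
  proof (rule ccontr)
    assume "(a, b) \<notin> ser"
    then have "count_list (profile b a (A # w) 0) 0 = count_list (profile b a u 0) 0"
      using assms a b unfolding same_profiles_def by (metis subsetD)
    then show False using a less by (simp only: zeros_profile up_to_first.simps) simp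
  qed
qed

lemma same_profiles_imp_equiv:
  assumes "w \<in> step_sequences \<Sigma> sim" "u \<in> step_sequences \<Sigma> sim" "same_profiles \<Sigma> ser w u"
  shows "w \<approx> u"
  using assms
proof (induction w arbitrary: u)
  case Nil
  have "u = []"
  proof (cases u)
    case (Cons B v)
    then obtain a where "a \<in> B" "a \<in> \<Sigma>"
      using Nil.prems(2) by (auto simp: step_sequences_def steps_def)
    then show ?thesis using same_profiles_occs[OF Nil.prems(3), of a] Cons by simp
  qed
  then show ?case by simp
next
  case (Cons A w)
  then have A: "A \<in> steps \<Sigma> sim" "A \<noteq> {}" "A \<subseteq> \<Sigma>" and w: "w \<in> step_sequences \<Sigma> sim"
    by (auto simp: step_sequences_def steps_def)
  obtain u' where u': "u' \<in> step_sequences \<Sigma> sim" "u \<approx> A # u'"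
    using equiv_step_in_front[OF Cons.prems(2) _ extractable_first_step[OF Cons.prems(3) A(3)]] A
    by (auto simp: opt_step_def opt_Cons_def)
  \<comment> \<open>Invariance under the congruence carries the profiles of \<open>u\<close> over to
    \<open>A # u'\<close>; now both sequences start with \<open>A\<close>, which can be
    cancelled.\<close>
  have "same_profiles \<Sigma> ser (A # w) (A # u')"
    using Cons.prems(3) profile_equiv[OF u'(2)] same_profiles_equivp by (metis equivp_transp)
  then have "w \<approx> u'" using Cons.IH[OF w u'(1)] same_profiles_ConsD by blast
  then show ?case using A(1) u'(2) by (blast intro: equiv_Cons equiv_trans equiv_sym)
qed

theorem equiv_iff_same_profiles:
  assumes "w \<in> step_sequences \<Sigma> sim" "u \<in> step_sequences \<Sigma> sim"
  shows "w \<approx> u \<longleftrightarrow> same_profiles \<Sigma> ser w u"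
  using assms same_profiles_imp_equiv profile_equiv by blast

end


section \<open>Timed weakest preconditions\<close>

text \<open>The postcondition also receives the running time. As \<open>exec\<close> is
  deterministic, the existential expresses total correctness.\<close>

definition wp :: "com \<Rightarrow> state \<Rightarrow> (nat \<Rightarrow> state \<Rightarrow> bool) \<Rightarrow> bool" where
  "wp c s Q \<longleftrightarrow> (\<exists>t s'. exec c s t s' \<and> Q t s')"

inductive_cases exec_elims:
  "exec Skip s t s'" "exec (Assign x e) s t s'" "exec (Write a e f) s t s'"
  "exec (Seq c d) s t s'" "exec (Cond b c d) s t s'"

lemma wp_simps [simp]:
  "wp Skip s Q \<longleftrightarrow> Q 1 s"
  "wp (Assign x e) s Q \<longleftrightarrow> Q (1 + acost e) (s\<lparr>regs := (regs s)(x := aval e s)\<rparr>)"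
  "wp (Write a e f) s Q \<longleftrightarrow> Q (1 + acost e + acost f)
     (s\<lparr>arrs := (arrs s)(a := (arrs s a)(aval e s := aval f s))\<rparr>)"
  "wp (Seq c d) s Q \<longleftrightarrow> wp c s (\<lambda>t s'. wp d s' (\<lambda>t'. Q (t + t')))"
  "wp (Cond b c d) s Q \<longleftrightarrow>
     (bval b s \<longrightarrow> wp c s (\<lambda>t. Q (1 + bcost b + t))) \<and>
     (\<not> bval b s \<longrightarrow> wp d s (\<lambda>t. Q (1 + bcost b + t)))"
  unfolding wp_def by (auto elim!: exec_elims) (blast intro: exec.intros[simplified])+

lemma wp_mono:
  assumes "wp c s Q" "\<And>t s'. Q t s' \<Longrightarrow> R t s'" shows "wp c s R"
  using assms unfolding wp_def by blast

lemma wp_While: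
  assumes "I 0 s"
    and "\<And>i s. i < N \<Longrightarrow> I i s \<Longrightarrow> bval b s"
    and "\<And>i s. i < N \<Longrightarrow> I i s \<Longrightarrow> wp c s (\<lambda>t s'. I (Suc i) s' \<and> 1 + bcost b + t \<le> T i)"
    and "\<And>s. I N s \<Longrightarrow> \<not> bval b s"
  shows "wp (While b c) s (\<lambda>t s'. I N s' \<and> t \<le> (\<Sum>i<N. T i) + 1 + bcost b)"
proof -
  \<comment> \<open>Generalised to a loop entered after \<open>m\<close> rounds, for an induction
    downwards from \<open>N\<close>.\<close>
  have "wp (While b c) s (\<lambda>t s'. I N s' \<and> t \<le> (\<Sum>i=m..<N. T i) + 1 + bcost b)"
    if "m \<le> N" "I m s" for m s
    using that
  proof (induction m arbitrary: s rule: inc_induct)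
    case base
    then show ?case using assms(4) unfolding wp_def by (auto intro!: exI WhileFalse)
  next
    case (step m)
    note b = assms(2)[OF step.hyps(2) step.prems]
    from assms(3)[OF step.hyps(2) step.prems] obtain t s' where
      c: "exec c s t s'" "I (Suc m) s'" "1 + bcost b + t \<le> T m"
      unfolding wp_def by blast
    from step.IH[OF c(2)] obtain t' s'' where
      w: "exec (While b c) s' t' s''" "I N s''" "t' \<le> (\<Sum>i=Suc m..<N. T i) + 1 + bcost b"
      unfolding wp_def by blast
    have "1 + bcost b + t + t' \<le> (\<Sum>i=m..<N. T i) + 1 + bcost b"
      using c(3) w(3) step.hyps(2) by (simp add: sum.atLeast_Suc_lessThan)
    then show ?case using WhileTrue[OF b c(1) w(1)] w(2) unfolding wp_def by blast
  qed
  from this[of 0 s] assms(1) show ?thesis by (simp add: atLeast0LessThan)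
qed


section \<open>The decision procedure\<close>

text \<open>Registers 0 to 3 hold the size of the alphabet, the two input lengths and the square of the
  size; 4 is a failure flag, 5, 6, 7 are positions in the input, 8 and 9 hold a pair of actions,
  10 its matrix index and 11 a number of occurrences. Arrays 4 and 5 count the occurrences of
  each action in the two sequences, and array 6 is the table of profiles.
  Such a number \<open>i\<close> is always stored as \<open>k * k * i\<close>, so that the address \<open>k * k * i + (b * k + a)\<close>
  of a table entry is found without multiplication.\<close>

definition pair_loop :: "com \<Rightarrow> com" where
  "pair_loop act = While (Less (Var 9) (Var 0))
     (Seq act (Seq (Assign 10 (Plus (Var 10) (Var 0))) (Assign 9 (Plus (Var 9) (Const 1)))))"

text \<open>\<open>X\<close> is the input array and \<open>N\<close> the array of counters. Register
  10 starts at \<open>a\<close> and grows by \<open>k\<close> with each \<open>b\<close>, hence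
  equals \<open>b * k + a\<close>; register 11 receives the scaled number of earlier
  \<open>a\<close>'s.\<close>

definition scan_loop :: "nat \<Rightarrow> nat \<Rightarrow> com \<Rightarrow> com" where
  "scan_loop X N act = While (Less (Var 7) (Var 6))
     (Seq (Assign 8 (Read X (Var 7))) (Seq (Assign 9 (Const 0)) (Seq (Assign 10 (Var 8))
     (Seq (Assign 11 (Read N (Var 8))) (Seq (pair_loop act) (Assign 7 (Plus (Var 7) (Const 1))))))))"

definition count_loop :: "nat \<Rightarrow> nat \<Rightarrow> com" where
  "count_loop X N = While (Less (Var 7) (Var 6))
     (Seq (Assign 8 (Read X (Var 7))) (Seq (Write N (Var 8) (Plus (Read N (Var 8)) (Var 3)))
     (Assign 7 (Plus (Var 7) (Const 1)))))"

text \<open>Each step is read twice: \<open>act\<close> is run on all its pairs before any of its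
  actions is counted. This order is what makes the counters refer to strictly earlier steps.\<close>

definition pass_loop :: "nat \<Rightarrow> nat \<Rightarrow> nat \<Rightarrow> com \<Rightarrow> com" where
  "pass_loop X L N act = Seq (Assign 5 (Const 0)) (While (Less (Var 5) (Var L))
     (Seq (Assign 6 (Plus (Plus (Var 5) (Const 1)) (Read X (Var 5))))
     (Seq (Assign 7 (Plus (Var 5) (Const 1))) (Seq (scan_loop X N act)
     (Seq (Assign 7 (Plus (Var 5) (Const 1))) (Seq (count_loop X N) (Assign 5 (Var 6))))))))"

section \<open>Verification of one pass over an encoded step sequence\<close>

definition encoding :: "nat list list \<Rightarrow> nat list" where
  "encoding xss = concat (map (\<lambda>xs. length xs # xs) xss)"

lemma encoding_simps [simp]:
  "encoding [] = []"
  "encoding (xs # xss) = length xs # xs @ encoding xss"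
  "encoding (xss @ yss) = encoding xss @ encoding yss"
  by (simp_all add: encoding_def)

lemma array_of_encoding:
  "array_of (encoding (pre @ xs # post)) (length (encoding pre)) = length xs"
  "j < length xs \<Longrightarrow>
    array_of (encoding (pre @ xs # post)) (Suc (length (encoding pre)) + j) = xs ! j"
  by (simp_all add: array_of_def nth_append)

text \<open>The counters on arrival at a step thus provide both the index of the profile entry and
  its value.\<close>

lemma profile_nth:
  assumes "a \<in> A"
  shows "profile a b (v @ A # w) 0 ! occs a v = occs b v"
  using assms by (simp add: profile_append nth_append)

text \<open>Both passes share their control flow, so \<open>act\<close> is left abstract.
  \<open>I S f M\<close> describes the flag \<open>f\<close> and the table \<open>M\<close> once the
  triples \<open>(a, b, i)\<close> in \<open>S\<close> have been treated, where \<open>i\<close>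
  numbers the occurrences of \<open>a\<close> from 0. The action may change only these two, in time
  at most \<open>T\<close>.\<close>

locale pass =
  fixes X L N :: nat and act :: com and k :: nat and xss :: "nat list list" and T :: nat
    and I :: "(nat \<times> nat \<times> nat) set \<Rightarrow> nat \<Rightarrow> (nat \<Rightarrow> nat) \<Rightarrow> bool" and s0 :: state
  assumes ids: "X \<noteq> N" "X \<noteq> 6" "N \<noteq> 6" "L \<le> 3"
    and init: "regs s0 0 = k" "regs s0 3 = k * k" "regs s0 L = length (encoding xss)"
      "arrs s0 X = array_of (encoding xss)" "arrs s0 N = (\<lambda>_. 0)"
      "I {} (regs s0 4) (arrs s0 6)"
    and steps: "\<And>xs. xs \<in> set xss \<Longrightarrow> distinct xs \<and> set xs \<subseteq> {..<k} \<and> xs \<noteq> []"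
    and act: "\<And>S a b i s. \<lbrakk>\<forall>r\<le>3. regs s r = regs s0 r; \<forall>r. r \<notin> {N, 6} \<longrightarrow> arrs s r = arrs s0 r;
      a < k; b < k; i < occs a (map set xss); I S (regs s 4) (arrs s 6);
      regs s 9 = b; regs s 10 = b * k + a; regs s 11 = k * k * i;
      arrs s N b = k * k * (profile a b (map set xss) 0 ! i)\<rbrakk> \<Longrightarrow>
      wp act s (\<lambda>t s'. t \<le> T \<and>
        (\<exists>f M. s' = s\<lparr>regs := (regs s)(4 := f), arrs := (arrs s)(6 := M)\<rparr> \<and>
          I (insert (a, b, i) S) f M))"
begin

definition frame :: "state \<Rightarrow> bool" where
  "frame s \<longleftrightarrow> (\<forall>r\<le>3. regs s r = regs s0 r) \<and> (\<forall>r. r \<notin> {N, 6} \<longrightarrow> arrs s r = arrs s0 r)"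

definition inv :: "(nat \<times> nat \<times> nat) set \<Rightarrow> state \<Rightarrow> bool" where
  "inv S s \<longleftrightarrow> I S (regs s 4) (arrs s 6)"

lemma frameD:
  assumes "frame s"
  shows "regs s 0 = k" "regs s 3 = k * k" "regs s L = length (encoding xss)"
    "arrs s X = array_of (encoding xss)"
  using assms ids init by (auto simp: frame_def)

lemma wp_pair_loop:
  assumes s: "frame s" "inv S s" "regs s 9 = 0" "regs s 10 = a" "regs s 11 = k * k * i"
    and a: "a < k" "i < occs a (map set xss)"
    and N: "\<forall>b<k. arrs s N b = k * k * (profile a b (map set xss) 0 ! i)"
  shows "wp (pair_loop act) s (\<lambda>t s'. frame s' \<and> inv (S \<union> {(a, b, i) |b. b < k}) s' \<and>
    arrs s' N = arrs s N \<and> (\<forall>r\<in>{5,6,7}. regs s' r = regs s r) \<and> t \<le> k * (T + 12) + 4)"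
proof -
  define J where "J b s' \<longleftrightarrow> frame s' \<and> inv (S \<union> {(a, b', i) |b'. b' < b}) s' \<and>
    arrs s' N = arrs s N \<and> (\<forall>r\<in>{5,6,7}. regs s' r = regs s r) \<and>
    regs s' 9 = b \<and> regs s' 10 = b * k + a \<and> regs s' 11 = k * k * i" for b s'
  \<comment> \<open>The overhead 12 consists of 4 units each for the test and the two
    increments.\<close>
  have "wp (pair_loop act) s (\<lambda>t s'. J k s' \<and>
    t \<le> (\<Sum>b<k. T + 12) + 1 + bcost (Less (Var 9) (Var 0)))"
    unfolding pair_loop_def
  proof (rule wp_While)
    show "J 0 s" using s by (simp add: J_def)
  next
    show "bval (Less (Var 9) (Var 0)) s1" if "b < k" "J b s1" for b s1
      using that frameD(1)[of s1] by (simp add: J_def)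
  next
    fix b s1 assume b: "b < k" and J: "J b s1"
    have ins: "insert (a, b, i) (S \<union> {(a, b', i) |b'. b' < b}) = S \<union> {(a, b', i) |b'. b' < Suc b}"
      by (auto simp: less_Suc_eq)
    have "wp act s1 (\<lambda>t s'. t \<le> T \<and>
        (\<exists>f M. s' = s1\<lparr>regs := (regs s1)(4 := f), arrs := (arrs s1)(6 := M)\<rparr> \<and>
          I (insert (a, b, i) (S \<union> {(a, b', i) |b'. b' < b})) f M))"
      by (rule act) (use J N a b in \<open>auto simp: J_def frame_def inv_def\<close>)
    then have "wp act s1 (\<lambda>t s'. t \<le> T \<and>
        (\<exists>f M. s' = s1\<lparr>regs := (regs s1)(4 := f), arrs := (arrs s1)(6 := M)\<rparr> \<and>
          I (S \<union> {(a, b', i) |b'. b' < Suc b}) f M))" unfolding ins .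
    then show "wp (Seq act (Seq (Assign 10 (Plus (Var 10) (Var 0))) (Assign 9 (Plus (Var 9) (Const 1))))) s1
        (\<lambda>t s'. J (Suc b) s' \<and> 1 + bcost (Less (Var 9) (Var 0)) + t \<le> T + 12)"
      using b J frameD(1)[of s1] ids unfolding J_def
      by (auto simp: frame_def inv_def elim!: wp_mono)
  next
    show "\<not> bval (Less (Var 9) (Var 0)) s1" if "J k s1" for s1
      using that frameD(1)[of s1] by (simp add: J_def)
  qed
  then show ?thesis by (rule wp_mono) (auto simp: J_def)
qed

context
  fixes pre xs post
  assumes split: "xss = pre @ xs # post"
begin

lemma xs: "distinct xs" "set xs \<subseteq> {..<k}" "xs \<noteq> []"
  using steps[of xs] split by auto

text \<open>Register 5 points to the length entry of the current step, register 6 just past its last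
  action.\<close>

definition at_step :: "state \<Rightarrow> bool" where
  "at_step s \<longleftrightarrow> frame s \<and> regs s 5 = length (encoding pre) \<and>
     regs s 6 = Suc (length (encoding pre)) + length xs"

lemma at_step_read:
  assumes "at_step s" "j < length xs" "regs s 7 = Suc (length (encoding pre)) + j"
  shows "arrs s X (regs s 7) = xs ! j"
  using assms array_of_encoding(2)[of j xs pre post] frameD(4)[of s] split
  by (simp add: at_step_def)

abbreviation finished :: "(nat \<times> nat \<times> nat) set" where
  "finished \<equiv> {(a, b, i). a < k \<and> b < k \<and> i < occs a (map set pre)}"

abbreviation current :: "nat set \<Rightarrow> (nat \<times> nat \<times> nat) set" where
  "current A \<equiv> {(a, b, i). a \<in> A \<and> b < k \<and> i = occs a (map set pre)}"

text \<open>The counters do not change during the scan, so all actions of the step are treated with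
  the counts of \<open>pre\<close>.\<close>

lemma wp_scan_loop:
  assumes s: "at_step s" "inv finished s" "regs s 7 = Suc (length (encoding pre))"
    and N: "\<forall>b<k. arrs s N b = k * k * occs b (map set pre)"
  shows "wp (scan_loop X N act) s (\<lambda>t s'. at_step s' \<and> inv (finished \<union> current (set xs)) s' \<and>
    arrs s' N = arrs s N \<and> t \<le> length xs * (k * (T + 12) + 30) + 4)"
proof -
  define J where "J j s' \<longleftrightarrow> at_step s' \<and> inv (finished \<union> current (set (take j xs))) s' \<and>
    arrs s' N = arrs s N \<and> regs s' 7 = Suc (length (encoding pre)) + j" for j s'
  have "wp (scan_loop X N act) s (\<lambda>t s'. J (length xs) s' \<and>
    t \<le> (\<Sum>j<length xs. k * (T + 12) + 30) + 1 + bcost (Less (Var 7) (Var 6)))"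
    unfolding scan_loop_def
  proof (rule wp_While)
    have empty: "{(a::nat, b::nat, i::nat). False} = {}" by auto
    then show "J 0 s" using s by (simp add: J_def empty)
  next
    show "bval (Less (Var 7) (Var 6)) s1" if "j < length xs" "J j s1" for j s1
      using that by (simp add: J_def at_step_def)
  next
    fix j s1 assume j: "j < length xs" and J: "J j s1"
    define a where "a = xs ! j"
    let ?S = "finished \<union> current (set (take j xs))"
    let ?i = "occs a (map set pre)"
    define s2 where "s2 = s1\<lparr>regs := (regs s1)(8 := a, 9 := 0, 10 := a, 11 := k * k * ?i)\<rparr>"
    have a: "a \<in> set xs" "a < k" using nth_mem[OF j] xs(2) by (auto simp: a_def)
    have read: "arrs s1 X (regs s1 7) = a"
      using at_step_read J j by (simp add: J_def a_def)
    have pn: "profile a b (map set xss) 0 ! ?i = occs b (map set pre)" for b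
      using profile_nth[of a "set xs" b "map set pre" "map set post"] a(1) split by simp
    have i: "?i < occs a (map set xss)" using a(1) split by simp
    have "wp (pair_loop act) s2 (\<lambda>t s'. frame s' \<and> inv (?S \<union> {(a, b, ?i) |b. b < k}) s' \<and>
      arrs s' N = arrs s2 N \<and> (\<forall>r\<in>{5,6,7}. regs s' r = regs s2 r) \<and> t \<le> k * (T + 12) + 4)"
      by (rule wp_pair_loop)
        (use J N a(2) i in \<open>auto simp: s2_def J_def frame_def inv_def at_step_def pn\<close>)
    moreover have "?S \<union> {(a, b, ?i) |b. b < k} = finished \<union> current (set (take (Suc j) xs))"
      using j by (auto simp: take_Suc_conv_app_nth a_def)
    ultimately have pair: "wp (pair_loop act) s2 (\<lambda>t s'. frame s' \<and>
      inv (finished \<union> current (set (take (Suc j) xs))) s' \<and>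
      arrs s' N = arrs s2 N \<and> (\<forall>r\<in>{5,6,7}. regs s' r = regs s2 r) \<and> t \<le> k * (T + 12) + 4)"
      by simp
    have "wp (pair_loop act) s2 (\<lambda>t s'. J (Suc j) (s'\<lparr>regs := (regs s')(7 := Suc (regs s' 7))\<rparr>) \<and>
      t \<le> k * (T + 12) + 4)"
    proof (rule wp_mono[OF pair], elim conjE, intro conjI)
      fix t and s' :: state
      assume "frame s'" "inv (finished \<union> current (set (take (Suc j) xs))) s'"
        "arrs s' N = arrs s2 N" "\<forall>r\<in>{5,6,7}. regs s' r = regs s2 r"
      then show "J (Suc j) (s'\<lparr>regs := (regs s')(7 := Suc (regs s' 7))\<rparr>)"
        using J by (simp add: J_def at_step_def frame_def inv_def s2_def)
    qed
    moreover have "arrs s1 N a = k * k * ?i" using J N a(2) by (simp add: J_def)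
    ultimately show "wp (Seq (Assign 8 (Read X (Var 7))) (Seq (Assign 9 (Const 0)) (Seq (Assign 10 (Var 8))
     (Seq (Assign 11 (Read N (Var 8))) (Seq (pair_loop act) (Assign 7 (Plus (Var 7) (Const 1)))))))) s1
        (\<lambda>t s'. J (Suc j) s' \<and> 1 + bcost (Less (Var 7) (Var 6)) + t \<le> k * (T + 12) + 30)"
      by (simp add: read s2_def) (erule wp_mono, simp)
  next
    show "\<not> bval (Less (Var 7) (Var 6)) s1" if "J (length xs) s1" for s1
      using that by (simp add: J_def at_step_def)
  qed
  then show ?thesis by (rule wp_mono) (auto simp: J_def)
qed

lemma wp_count_loop:
  assumes s: "at_step s" "inv S s" "regs s 7 = Suc (length (encoding pre))"
    and N: "\<forall>b<k. arrs s N b = k * k * occs b (map set pre)"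
  shows "wp (count_loop X N) s (\<lambda>t s'. at_step s' \<and> inv S s' \<and>
    (\<forall>b<k. arrs s' N b = k * k * occs b (map set (pre @ [xs]))) \<and> t \<le> length xs * 20 + 4)"
proof -
  define J where "J j s' \<longleftrightarrow> at_step s' \<and> inv S s' \<and>
    (\<forall>b<k. arrs s' N b = k * k * (occs b (map set pre) + of_bool (b \<in> set (take j xs)))) \<and>
    regs s' 7 = Suc (length (encoding pre)) + j" for j s'
  have "wp (count_loop X N) s (\<lambda>t s'. J (length xs) s' \<and>
    t \<le> (\<Sum>j<length xs. 20) + 1 + bcost (Less (Var 7) (Var 6)))"
    unfolding count_loop_def
  proof (rule wp_While)
    show "J 0 s" using s N by (simp add: J_def)
  next
    show "bval (Less (Var 7) (Var 6)) s1" if "j < length xs" "J j s1" for j s1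
      using that by (simp add: J_def at_step_def)
  next
    fix j s1 assume j: "j < length xs" and J: "J j s1"
    have read: "arrs s1 X (regs s1 7) = xs ! j"
      using at_step_read J j by (simp add: J_def)
    define s2 where "s2 = s1\<lparr>regs := (regs s1)(8 := xs ! j, 7 := Suc (regs s1 7)),
      arrs := (arrs s1)(N := (arrs s1 N)(xs ! j := arrs s1 N (xs ! j) + k * k))\<rparr>"
    \<comment> \<open>As the written actions are distinct, this counter has not yet been raised for
      the current step.\<close>
    have "xs ! j \<notin> set (take j xs)"
      using xs(1) j by (auto simp: in_set_conv_nth nth_eq_iff_index_eq)
    moreover have "xs ! j < k" using xs(2) nth_mem[OF j] by auto
    moreover have "set (take (Suc j) xs) = insert (xs ! j) (set (take j xs))"
      using j by (simp add: take_Suc_conv_app_nth)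
    ultimately have "\<forall>b<k. arrs s2 N b =
        k * k * (occs b (map set pre) + of_bool (b \<in> set (take (Suc j) xs)))"
      using J by (simp add: J_def s2_def)
    moreover have "at_step s2" "inv S s2" "regs s2 7 = Suc (length (encoding pre)) + Suc j"
      using J ids by (simp_all add: J_def s2_def at_step_def inv_def frame_def)
    ultimately have "J (Suc j) s2" by (simp add: J_def)
    moreover have "regs s1 3 = k * k" using J frameD(2) by (simp add: J_def at_step_def)
    then have "wp (Seq (Assign 8 (Read X (Var 7))) (Seq (Write N (Var 8) (Plus (Read N (Var 8)) (Var 3)))
         (Assign 7 (Plus (Var 7) (Const 1))))) s1
        (\<lambda>t s'. s' = s2 \<and> 1 + bcost (Less (Var 7) (Var 6)) + t \<le> 20)"
      using ids by (simp add: read s2_def fun_upd_twist)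
    ultimately show "wp (Seq (Assign 8 (Read X (Var 7))) (Seq (Write N (Var 8) (Plus (Read N (Var 8)) (Var 3)))
         (Assign 7 (Plus (Var 7) (Const 1))))) s1
        (\<lambda>t s'. J (Suc j) s' \<and> 1 + bcost (Less (Var 7) (Var 6)) + t \<le> 20)"
      by (auto elim: wp_mono simp del: wp_simps)
  next
    show "\<not> bval (Less (Var 7) (Var 6)) s1" if "J (length xs) s1" for s1
      using that by (simp add: J_def at_step_def)
  qed
  then show ?thesis by (rule wp_mono) (auto simp: J_def)
qed

end

lemma wp_pass_loop:
  "wp (pass_loop X L N act) s0 (\<lambda>t s'. (\<forall>r\<le>3. regs s' r = regs s0 r) \<and>
     (\<forall>r. r \<notin> {N, 6} \<longrightarrow> arrs s' r = arrs s0 r) \<and>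
     I {(a, b, i). a < k \<and> b < k \<and> i < occs a (map set xss)} (regs s' 4) (arrs s' 6) \<and>
     (\<forall>b<k. arrs s' N b = k * k * occs b (map set xss)) \<and>
     t \<le> sum_list (map length xss) * k * (T + 100) + 6)"
proof -
  define J where "J m s \<longleftrightarrow> frame s \<and>
    inv {(a, b, i). a < k \<and> b < k \<and> i < occs a (map set (take m xss))} s \<and>
    (\<forall>b<k. arrs s N b = k * k * occs b (map set (take m xss))) \<and>
    regs s 5 = length (encoding (take m xss))" for m s
  define s1 where "s1 = s0\<lparr>regs := (regs s0)(5 := 0)\<rparr>"
  let ?loop = "While (Less (Var 5) (Var L))
     (Seq (Assign 6 (Plus (Plus (Var 5) (Const 1)) (Read X (Var 5))))
     (Seq (Assign 7 (Plus (Var 5) (Const 1))) (Seq (scan_loop X N act)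
     (Seq (Assign 7 (Plus (Var 5) (Const 1))) (Seq (count_loop X N) (Assign 5 (Var 6)))))))"
  have "wp ?loop s1 (\<lambda>t s'. J (length xss) s' \<and>
    t \<le> (\<Sum>m<length xss. length (xss ! m) * k * (T + 100)) + 1 + bcost (Less (Var 5) (Var L)))"
  proof (rule wp_While)
    have empty: "{(a::nat, b::nat, i::nat). False} = {}" by auto
    then show "J 0 s1" using init by (simp add: empty J_def s1_def frame_def inv_def)
  next
    show "bval (Less (Var 5) (Var L)) s2" if "m < length xss" "J m s2" for m s2
      using that frameD(3)[of s2] id_take_nth_drop[of m xss]
      by (metis (no_types, lifting) J_def aval.simps(2) bval.simps(1) encoding_simps(2,3)
          length_append length_Cons less_add_same_cancel1 zero_less_Suc)
  next
    fix m s2 assume m: "m < length xss" and J: "J m s2"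
    define pre xs post where "pre = take m xss" "xs = xss ! m" "post = drop (Suc m) xss"
    have split: "xss = pre @ xs # post" unfolding pre_xs_post_def
      using m by (simp add: id_take_nth_drop)
    have pre': "take (Suc m) xss = pre @ [xs]"
      using m by (simp add: pre_xs_post_def take_Suc_conv_app_nth)
    note xs = xs[OF split]
    note J' = J[unfolded J_def, folded pre_xs_post_def]
    from xs(2,3) have pos: "1 \<le> length xs" "1 \<le> k" by (cases xs; auto simp: Suc_le_eq)+
    have f: "frame s2" and p: "regs s2 5 = length (encoding pre)"
      using J' by simp_all
    have read: "arrs s2 X (regs s2 5) = length xs"
      using array_of_encoding(1)[of pre xs post] frameD(4)[OF f] p split by simp
    define s3 where "s3 = s2\<lparr>regs := (regs s2)(6 := Suc (length (encoding pre)) + length xs,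
      7 := Suc (length (encoding pre)))\<rparr>"
    let ?done = "{(a, b, i). a < k \<and> b < k \<and> i < occs a (map set pre)}"
    let ?cur = "{(a, b, i). a \<in> set xs \<and> b < k \<and> i = occs a (map set pre)}"
    have un: "?done \<union> ?cur = {(a, b, i). a < k \<and> b < k \<and> i < occs a (map set (pre @ [xs]))}"
      using xs(2) by (auto split: if_splits simp: of_bool_def)
    have "wp (scan_loop X N act) s3 (\<lambda>t s'. at_step pre xs s' \<and> inv (?done \<union> ?cur) s' \<and>
      arrs s' N = arrs s3 N \<and> t \<le> length xs * (k * (T + 12) + 30) + 4)"
      by (rule wp_scan_loop[OF split])
        (use J' in \<open>auto simp: s3_def at_step_def[OF split] frame_def inv_def\<close>)
    then have scan_count: "wp (scan_loop X N act) s3 (\<lambda>t s'. t \<le> length xs * (k * (T + 12) + 30) + 4 \<and>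
      wp (count_loop X N) (s'\<lparr>regs := (regs s')(7 := Suc (length (encoding pre)))\<rparr>)
       (\<lambda>t s'. at_step pre xs s' \<and> inv (?done \<union> ?cur) s' \<and>
         (\<forall>b<k. arrs s' N b = k * k * occs b (map set (pre @ [xs]))) \<and> t \<le> length xs * 20 + 4) \<and>
         regs s' 5 = length (encoding pre))"
    proof (rule wp_mono, intro conjI, goal_cases)
      case (2 t s')
      show ?case
        by (rule wp_count_loop[OF split])
          (use J' 2 in \<open>auto simp: s3_def at_step_def[OF split] frame_def inv_def\<close>)
    qed (auto simp: at_step_def[OF split])
    \<comment> \<open>Steps are nonempty and \<open>k \<ge> 1\<close>, so the overhead per step and
      per action can be charged to the \<open>k * length xs\<close> runs of
      \<open>act\<close>.\<close>
    have cost: "length xs * (k * (T + 12) + 30) + length xs * 20 + 30 \<le> length xs * k * (T + 100)"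
    proof -
      define q where "q = k * length xs"
      have "length xs \<le> q" using pos(2) by (simp add: q_def)
      moreover have "length xs * (k * (T + 12) + 30) = q * (T + 12) + length xs * 30"
        by (simp add: q_def algebra_simps)
      moreover have "length xs * k * (T + 100) = q * (T + 12) + q * 88"
        by (simp add: q_def algebra_simps)
      ultimately show ?thesis using pos(1) by linarith
    qed
    show "wp (Seq (Assign 6 (Plus (Plus (Var 5) (Const 1)) (Read X (Var 5))))
     (Seq (Assign 7 (Plus (Var 5) (Const 1))) (Seq (scan_loop X N act)
     (Seq (Assign 7 (Plus (Var 5) (Const 1))) (Seq (count_loop X N) (Assign 5 (Var 6))))))) s2
      (\<lambda>t s'. J (Suc m) s' \<and> 1 + bcost (Less (Var 5) (Var L)) + t \<le>
        length (xss ! m) * k * (T + 100))"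
      using scan_count[unfolded un] cost unfolding s3_def
      by (auto simp: read[unfolded p] p J_def pre' at_step_def[OF split] frame_def inv_def
          simp flip: pre_xs_post_def elim!: wp_mono)
  next
    show "\<not> bval (Less (Var 5) (Var L)) s" if "J (length xss) s" for s
      using that frameD(3) by (simp add: J_def)
  qed
  moreover have "(\<Sum>m<length xss. length (xss ! m) * k * (T + 100)) =
    sum_list (map length xss) * k * (T + 100)"
    by (simp add: sum_list_sum_nth sum_distrib_right atLeast0LessThan)
  ultimately show ?thesis
    unfolding pass_loop_def
    by (auto simp: J_def frame_def inv_def simp flip: s1_def elim!: wp_mono)
qed

end

section \<open>The concrete actions and the complete program\<close>

definition record_entry :: com where
  "record_entry = Write 6 (Plus (Var 11) (Var 10)) (Read 4 (Var 9))"

text \<open>Register 10 is also the index of the cell for \<open>(b, a)\<close> in the matrix of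
  \<open>ser\<close>, so exempted pairs are skipped.\<close>

definition compare_entry :: com where
  "compare_entry = Cond (Conj (Equal (Read 1 (Var 10)) (Const 0))
       (Neg (Equal (Read 6 (Plus (Var 11) (Var 10))) (Read 5 (Var 9)))))
     (Assign 4 (Const 1)) Skip"

text \<open>Lacking multiplication, the machine obtains \<open>k * k\<close> by \<open>k\<close>
  additions, in time linear in \<open>k\<close>.\<close>

definition square_size :: com where
  "square_size = Seq (Assign 5 (Const 0)) (While (Less (Var 5) (Var 0))
     (Seq (Assign 3 (Plus (Var 3) (Var 0))) (Assign 5 (Plus (Var 5) (Const 1)))))"

text \<open>The second pass visits only occurrences in the second sequence. Surplus occurrences in
  the first go unnoticed there, and surplus ones in the second are compared with unwritten entries;
  equal totals exclude both.\<close>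

definition compare_totals :: com where
  "compare_totals = Seq (Assign 9 (Const 0)) (While (Less (Var 9) (Var 0))
     (Seq (Cond (Equal (Read 4 (Var 9)) (Read 5 (Var 9))) Skip (Assign 4 (Const 1)))
     (Assign 9 (Plus (Var 9) (Const 1)))))"

definition decide_equiv :: com where
  "decide_equiv = Seq square_size (Seq (pass_loop 2 1 4 record_entry)
     (Seq (pass_loop 3 2 5 compare_entry)
     (Seq compare_totals (Assign 0 (Minus (Const 1) (Var 4))))))"

lemma wp_square_size:
  fixes s :: state
  assumes "regs s 3 = 0"
  shows "wp square_size s (\<lambda>t s'. regs s' 3 = regs s 0 * regs s 0 \<and>
    (\<forall>r. r \<notin> {3, 5} \<longrightarrow> regs s' r = regs s r) \<and> arrs s' = arrs s \<and> t \<le> regs s 0 * 20 + 6)"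
proof -
  define J where "J i s' \<longleftrightarrow> regs s' 3 = i * regs s 0 \<and> regs s' 5 = i \<and>
    (\<forall>r. r \<notin> {3, 5} \<longrightarrow> regs s' r = regs s r) \<and> arrs s' = arrs s" for i and s' :: state
  define s1 where "s1 = s\<lparr>regs := (regs s)(5 := 0)\<rparr>"
  have "wp (While (Less (Var 5) (Var 0))
     (Seq (Assign 3 (Plus (Var 3) (Var 0))) (Assign 5 (Plus (Var 5) (Const 1))))) s1
    (\<lambda>t s'. J (regs s 0) s' \<and> t \<le> (\<Sum>i<regs s 0. 20) + 1 + bcost (Less (Var 5) (Var 0)))"
    by (rule wp_While) (use assms in \<open>auto simp: J_def s1_def\<close>)
  then show ?thesis
    unfolding square_size_def by (auto simp: J_def simp flip: s1_def elim!: wp_mono)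
qed

lemma wp_compare_totals:
  fixes s :: state
  shows "wp compare_totals s (\<lambda>t s'.
     regs s' 4 = (if \<forall>b<regs s 0. arrs s 4 b = arrs s 5 b then regs s 4 else 1) \<and>
     t \<le> regs s 0 * 20 + 6)"
proof -
  define J where "J i s' \<longleftrightarrow> regs s' 9 = i \<and> regs s' 0 = regs s 0 \<and> arrs s' = arrs s \<and>
    regs s' 4 = (if \<forall>b<i. arrs s 4 b = arrs s 5 b then regs s 4 else 1)" for i and s' :: state
  define s1 where "s1 = s\<lparr>regs := (regs s)(9 := 0)\<rparr>"
  have "wp (While (Less (Var 9) (Var 0))
     (Seq (Cond (Equal (Read 4 (Var 9)) (Read 5 (Var 9))) Skip (Assign 4 (Const 1)))
     (Assign 9 (Plus (Var 9) (Const 1))))) s1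
    (\<lambda>t s'. J (regs s 0) s' \<and> t \<le> (\<Sum>i<regs s 0. 20) + 1 + bcost (Less (Var 9) (Var 0)))"
    by (rule wp_While) (auto simp: J_def s1_def less_Suc_eq)
  then show ?thesis
    unfolding compare_totals_def by (auto simp: J_def simp flip: s1_def elim!: wp_mono)
qed

section \<open>Addresses in the table and in the matrices\<close>

lemma pair_index_less: "a < k \<Longrightarrow> b < k \<Longrightarrow> b * k + a < k * (k::nat)"
  using mult_le_mono1[of "Suc b" k k] by simp

text \<open>\<open>i\<close>, \<open>b\<close>, \<open>a\<close> are the digits of the address for
  the weights \<open>k * k\<close>, \<open>k\<close> and 1. Hence no write destroys the entry of
  another triple.\<close>

lemma entry_address_inj:
  fixes k :: nat
  assumes "k * k * i + (b * k + a) = k * k * j + (d * k + c)" "a < k" "b < k" "c < k" "d < k"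
  shows "a = c \<and> b = d \<and> i = j"
proof -
  have less: "b * k + a < k * k" "d * k + c < k * k" using assms pair_index_less by auto
  have "(k * k * i + (b * k + a)) mod (k * k) = (k * k * j + (d * k + c)) mod (k * k)"
    using assms(1) by simp
  then have eq: "b * k + a = d * k + c" using less by simp
  then have "(b * k + a) mod k = (d * k + c) mod k" by simp
  then have "a = c" using assms by simp
  then show ?thesis using eq assms by auto
qed

lemma array_of_matrix:
  assumes "a < k" "b < k"
  shows "array_of (matrix k r) (b * k + a) = of_bool ((b, a) \<in> r)"
proof -
  have "(b * k + a) div k = b" "(b * k + a) mod k = a" using assms by auto
  then show ?thesis using pair_index_less[OF assms] by (simp add: array_of_def matrix_def)
qed

text \<open>The bounds on \<open>a\<close> and \<open>b\<close> are kept in the invariant so that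
  \<open>entry_address_inj\<close> applies to every triple recorded earlier.\<close>

definition recorded :: "nat \<Rightarrow> nat list list \<Rightarrow> (nat \<times> nat \<times> nat) set \<Rightarrow> nat \<Rightarrow> (nat \<Rightarrow> nat) \<Rightarrow> bool" where
  "recorded k xss S f M \<longleftrightarrow> f = 0 \<and> (\<forall>(a, b, i)\<in>S. a < k \<and> b < k \<and>
     M (k * k * i + (b * k + a)) = k * k * (profile a b (map set xss) 0 ! i))"

definition compared ::
    "nat \<Rightarrow> (nat \<times> nat) set \<Rightarrow> nat list list \<Rightarrow> (nat \<Rightarrow> nat) \<Rightarrow> (nat \<times> nat \<times> nat) set \<Rightarrow> nat \<Rightarrow> (nat \<Rightarrow> nat) \<Rightarrow> bool" where
  "compared k r yss M0 S f M \<longleftrightarrow> M = M0 \<and>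
     f = of_bool (\<exists>(a, b, i)\<in>S. (b, a) \<notin> r \<and>
       M (k * k * i + (b * k + a)) \<noteq> k * k * (profile a b (map set yss) 0 ! i))"

text \<open>Recording costs 6 units and comparing at most 16; the bound 20 serves for both
  passes.\<close>

lemma pass_record:
  assumes "regs s 0 = k" "regs s 3 = k * k" "regs s 1 = length (encoding xss)" "regs s 4 = 0"
    "arrs s 2 = array_of (encoding xss)" "arrs s 4 = (\<lambda>_. 0)"
    "\<forall>xs\<in>set xss. distinct xs \<and> set xs \<subseteq> {..<k} \<and> xs \<noteq> []"
  shows "pass 2 1 4 record_entry k xss 20 (recorded k xss) s"
proof
  show "recorded k xss {} (regs s 4) (arrs s 6)" using assms(4) by (simp add: recorded_def)
next
  fix S a b i and s1 :: state
  assume *: "a < k" "b < k" "recorded k xss S (regs s1 4) (arrs s1 6)" "regs s1 9 = b"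
    "regs s1 10 = b * k + a" "regs s1 11 = k * k * i"
    "arrs s1 4 b = k * k * (profile a b (map set xss) 0 ! i)"
  define M where "M = (arrs s1 6)(k * k * i + (b * k + a) := arrs s1 4 b)"
  have "recorded k xss (insert (a, b, i) S) 0 M"
    unfolding recorded_def
  proof (intro conjI refl ballI, clarify, intro conjI)
    fix c d j assume "(c, d, j) \<in> insert (a, b, i) S"
    then consider "c = a" "d = b" "j = i" | "(c, d, j) \<in> S" by auto
    note cases = this
    show less: "c < k" "d < k" using cases *(1-3) by (cases; auto simp: recorded_def)+
    show "M (k * k * j + (d * k + c)) = k * k * (profile c d (map set xss) 0 ! j)"
    proof (cases "c = a \<and> d = b \<and> j = i")
      case True
      then show ?thesis using *(7) by (simp add: M_def)
    next
      case False
      then have "k * k * j + (d * k + c) \<noteq> k * k * i + (b * k + a)"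
        using entry_address_inj[of k j d c i b a] less *(1,2) by blast
      moreover have "(c, d, j) \<in> S" using cases False by blast
      ultimately show ?thesis using *(3) by (auto simp: M_def recorded_def)
    qed
  qed
  moreover have "wp record_entry s1 (\<lambda>t s'. t \<le> 20 \<and>
      s' = s1\<lparr>regs := (regs s1)(4 := 0), arrs := (arrs s1)(6 := M)\<rparr>)"
    using * by (simp add: record_entry_def M_def recorded_def fun_upd_idem)
  ultimately show "wp record_entry s1 (\<lambda>t s'. t \<le> 20 \<and>
    (\<exists>f M. s' = s1\<lparr>regs := (regs s1)(4 := f), arrs := (arrs s1)(6 := M)\<rparr> \<and>
      recorded k xss (insert (a, b, i) S) f M))"
    by (elim wp_mono) blast
qed (use assms in auto)

lemma pass_compare:
  assumes "regs s 0 = k" "regs s 3 = k * k" "regs s 2 = length (encoding yss)" "regs s 4 = 0"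
    "arrs s 1 = array_of (matrix k r)" "arrs s 3 = array_of (encoding yss)" "arrs s 5 = (\<lambda>_. 0)"
    "\<And>ys. ys \<in> set yss \<Longrightarrow> distinct ys \<and> set ys \<subseteq> {..<k} \<and> ys \<noteq> []"
  shows "pass 3 2 5 compare_entry k yss 20 (compared k r yss (arrs s 6)) s"
proof
  show "compared k r yss (arrs s 6) {} (regs s 4) (arrs s 6)"
    using assms(4) by (simp add: compared_def)
next
  fix S a b i and s1 :: state
  assume *: "a < k" "b < k" "compared k r yss (arrs s 6) S (regs s1 4) (arrs s1 6)" "regs s1 9 = b"
    "regs s1 10 = b * k + a" "regs s1 11 = k * k * i"
    "arrs s1 5 b = k * k * (profile a b (map set yss) 0 ! i)"
    "\<forall>r. r \<notin> {5, 6} \<longrightarrow> arrs s1 r = arrs s r"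
  define bad where "bad \<longleftrightarrow> (b, a) \<notin> r \<and>
    arrs s1 6 (k * k * i + (b * k + a)) \<noteq> k * k * (profile a b (map set yss) 0 ! i)"
  define f where "f = (if bad then 1 else regs s1 4)"
  have "arrs s1 1 (b * k + a) = of_bool ((b, a) \<in> r)"
    using *(1,2,8) assms(5) array_of_matrix by simp
  then have "wp compare_entry s1 (\<lambda>t s'. t \<le> 20 \<and>
      s' = s1\<lparr>regs := (regs s1)(4 := f), arrs := (arrs s1)(6 := arrs s1 6)\<rparr>)"
    using * by (auto simp: compare_entry_def f_def bad_def)
  moreover have "compared k r yss (arrs s 6) (insert (a, b, i) S) f (arrs s1 6)"
    using *(3) by (auto simp: compared_def f_def bad_def)
  ultimately show "wp compare_entry s1 (\<lambda>t s'. t \<le> 20 \<and>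
    (\<exists>f M. s' = s1\<lparr>regs := (regs s1)(4 := f), arrs := (arrs s1)(6 := M)\<rparr> \<and>
      compared k r yss (arrs s 6) (insert (a, b, i) S) f M))"
    by (elim wp_mono) blast
qed (use assms in auto)

text \<open>Equal profiles give equal totals by the diagonal pairs, so every entry inspected in the
  second pass was recorded in the first. Conversely, equal totals make the profiles equally long, so
  the second pass inspects every position, and the factor \<open>k * k\<close> cancels.\<close>

lemma same_profiles_iff_checks:
  assumes irr: "\<forall>a<k. (a, a) \<notin> r" and k: "0 < k"
    and rec: "recorded k xss {(a, b, i). a < k \<and> b < k \<and> i < occs a (map set xss)} g M"
    and cmp: "compared k r yss M {(a, b, i). a < k \<and> b < k \<and> i < occs a (map set yss)} f M'"
  shows "same_profiles {..<k} r (map set xss) (map set yss) \<longleftrightarrow>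
    f = 0 \<and> (\<forall>b<k. occs b (map set xss) = occs b (map set yss))"
proof
  assume same: "same_profiles {..<k} r (map set xss) (map set yss)"
  have occs: "occs b (map set xss) = occs b (map set yss)" if "b < k" for b
    using same irr that unfolding same_profiles_def by (metis length_profile lessThan_iff)
  moreover have "f = 0"
  proof -
    have "M (k * k * i + (b * k + a)) = k * k * (profile a b (map set yss) 0 ! i)"
      if "a < k" "b < k" "i < occs a (map set yss)" "(b, a) \<notin> r" for a b i
    proof -
      have "M (k * k * i + (b * k + a)) = k * k * (profile a b (map set xss) 0 ! i)"
        using rec occs that by (auto simp: recorded_def)
      then show ?thesis using same that by (simp add: same_profiles_def)
    qed
    then show ?thesis using cmp by (auto simp: compared_def)
  qed
  ultimately show "f = 0 \<and> (\<forall>b<k. occs b (map set xss) = occs b (map set yss))" by blast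
next
  assume *: "f = 0 \<and> (\<forall>b<k. occs b (map set xss) = occs b (map set yss))"
  show "same_profiles {..<k} r (map set xss) (map set yss)"
    unfolding same_profiles_def
  proof (intro ballI impI nth_equalityI)
    fix a b i assume ab: "a \<in> {..<k}" "b \<in> {..<k}" "(b, a) \<notin> r"
    show "length (profile a b (map set xss) 0) = length (profile a b (map set yss) 0)"
      using * ab by simp
    assume "i < length (profile a b (map set xss) 0)"
    then have i: "i < occs a (map set xss)" "i < occs a (map set yss)" using * ab by auto
    have "k * k * (profile a b (map set xss) 0 ! i) = M (k * k * i + (b * k + a))"
      using rec ab i unfolding recorded_def by auto
    also have "\<dots> = k * k * (profile a b (map set yss) 0 ! i)"
      using cmp * ab i unfolding compared_def by auto
    finally show "profile a b (map set xss) 0 ! i = profile a b (map set yss) 0 ! i"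
      using k by simp
  qed
qed

lemma wp_decide_equiv:
  assumes k: "0 < k"
    and regs: "regs s = (\<lambda>_. 0)(0 := k, 1 := length (encoding xss), 2 := length (encoding yss))"
    and arrs: "arrs s 1 = array_of (matrix k r)" "arrs s 2 = array_of (encoding xss)"
      "arrs s 3 = array_of (encoding yss)" "arrs s 4 = (\<lambda>_. 0)" "arrs s 5 = (\<lambda>_. 0)"
    and steps: "\<And>xs. xs \<in> set xss \<union> set yss \<Longrightarrow> distinct xs \<and> set xs \<subseteq> {..<k} \<and> xs \<noteq> []"
    and irr: "\<forall>a<k. (a, a) \<notin> r"
  shows "wp decide_equiv s (\<lambda>t s'.
    regs s' 0 = of_bool (same_profiles {..<k} r (map set xss) (map set yss)) \<and>
    t \<le> (sum_list (map length xss) + sum_list (map length yss) + 1) * k * 120)"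
proof -
  let ?X = "sum_list (map length xss)" and ?Y = "sum_list (map length yss)"
  let ?same = "same_profiles {..<k} r (map set xss) (map set yss)"
  have sq: "wp square_size s (\<lambda>t s'. regs s' 3 = regs s 0 * regs s 0 \<and>
    (\<forall>r. r \<notin> {3, 5} \<longrightarrow> regs s' r = regs s r) \<and> arrs s' = arrs s \<and> t \<le> regs s 0 * 20 + 6)"
    by (rule wp_square_size) (simp add: regs)
  show ?thesis
    unfolding decide_equiv_def wp_simps
  proof (rule wp_mono[OF sq])
    fix t1 and s1 :: state
    assume s1: "regs s1 3 = regs s 0 * regs s 0 \<and> (\<forall>r. r \<notin> {3, 5} \<longrightarrow> regs s1 r = regs s r) \<and>
      arrs s1 = arrs s \<and> t1 \<le> regs s 0 * 20 + 6"
    have p1: "pass 2 1 4 record_entry k xss 20 (recorded k xss) s1"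
      by (rule pass_record) (use s1 regs arrs steps in auto)
    show "wp (pass_loop 2 1 4 record_entry) s1 (\<lambda>t s'. wp (pass_loop 3 2 5 compare_entry) s'
      (\<lambda>t' s'. wp compare_totals s' (\<lambda>t'' s'.
        regs (s'\<lparr>regs := (regs s')(0 := aval (Minus (Const 1) (Var 4)) s')\<rparr>) 0 = of_bool ?same \<and>
        t1 + (t + (t' + (t'' + (1 + acost (Minus (Const 1) (Var 4)))))) \<le> (?X + ?Y + 1) * k * 120)))"
    proof (rule wp_mono[OF pass.wp_pass_loop[OF p1]], elim conjE)
      fix t2 and s2 :: state
      assume s2: "\<forall>r\<le>3. regs s2 r = regs s1 r" "\<forall>r. r \<notin> {4, 6} \<longrightarrow> arrs s2 r = arrs s1 r"
        "recorded k xss {(a, b, i). a < k \<and> b < k \<and> i < occs a (map set xss)} (regs s2 4) (arrs s2 6)"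
        "\<forall>b<k. arrs s2 4 b = k * k * occs b (map set xss)" "t2 \<le> ?X * k * (20 + 100) + 6"
      have p2: "pass 3 2 5 compare_entry k yss 20 (compared k r yss (arrs s2 6)) s2"
        by (rule pass_compare) (use s1 s2 regs arrs steps in \<open>auto simp: recorded_def\<close>)
      show "wp (pass_loop 3 2 5 compare_entry) s2
        (\<lambda>t' s'. wp compare_totals s' (\<lambda>t'' s'.
          regs (s'\<lparr>regs := (regs s')(0 := aval (Minus (Const 1) (Var 4)) s')\<rparr>) 0 = of_bool ?same \<and>
          t1 + (t2 + (t' + (t'' + (1 + acost (Minus (Const 1) (Var 4)))))) \<le> (?X + ?Y + 1) * k * 120))"
      proof (rule wp_mono[OF pass.wp_pass_loop[OF p2]], elim conjE)
        fix t3 and s3 :: state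
        assume s3: "\<forall>r\<le>3. regs s3 r = regs s2 r" "\<forall>r. r \<notin> {5, 6} \<longrightarrow> arrs s3 r = arrs s2 r"
          "compared k r yss (arrs s2 6) {(a, b, i). a < k \<and> b < k \<and> i < occs a (map set yss)}
             (regs s3 4) (arrs s3 6)"
          "\<forall>b<k. arrs s3 5 b = k * k * occs b (map set yss)" "t3 \<le> ?Y * k * (20 + 100) + 6"
        have k3: "regs s3 0 = k" using s1 s2(1) s3(1) regs by simp
        have same: "?same \<longleftrightarrow> regs s3 4 = 0 \<and> (\<forall>b<k. arrs s3 4 b = arrs s3 5 b)"
          using same_profiles_iff_checks[OF irr k s2(3) s3(3)] s2(4) s3(2,4) k by simp
        have flag: "regs s3 4 \<le> 1" using s3(3) by (auto simp: compared_def)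
        show "wp compare_totals s3 (\<lambda>t'' s'.
          regs (s'\<lparr>regs := (regs s')(0 := aval (Minus (Const 1) (Var 4)) s')\<rparr>) 0 = of_bool ?same \<and>
          t1 + (t2 + (t3 + (t'' + (1 + acost (Minus (Const 1) (Var 4)))))) \<le> (?X + ?Y + 1) * k * 120)"
        proof (rule wp_mono[OF wp_compare_totals], elim conjE)
          fix t4 and s4 :: state
          assume s4: "regs s4 4 = (if \<forall>b<regs s3 0. arrs s3 4 b = arrs s3 5 b then regs s3 4 else 1)"
            "t4 \<le> regs s3 0 * 20 + 6"
          have "1 - regs s4 4 = of_bool ?same"
            using s4(1) flag unfolding same k3 by auto
          \<comment> \<open>Beyond 120 units per occurrence and \<open>b\<close>, at most
            \<open>40 * k + 28\<close> remain for the two loops over the alphabet and the constants.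
            The \<open>+ 1\<close> in the bound pays for them, even if both sequences are
            empty.\<close>
          moreover have "t1 + t2 + t3 + t4 + 4 \<le> (?X + ?Y + 1) * k * 120"
          proof -
            have "t1 \<le> k * 20 + 6" using s1 regs by simp
            moreover have "t4 \<le> k * 20 + 6" using s4(2) k3 by simp
            moreover have "(?X + ?Y + 1) * k * 120 = ?X * k * 120 + ?Y * k * 120 + k * 120"
              by (simp add: algebra_simps)
            moreover have "t2 \<le> ?X * k * 120 + 6" "t3 \<le> ?Y * k * 120 + 6"
              using s2(5) s3(5) by simp_all
            ultimately show ?thesis using k by linarith
          qed
          ultimately show "regs (s4\<lparr>regs := (regs s4)(0 := aval (Minus (Const 1) (Var 4)) s4)\<rparr>) 0 =
              of_bool ?same \<and>
            t1 + (t2 + (t3 + (t4 + (1 + acost (Minus (Const 1) (Var 4)))))) \<le> (?X + ?Y + 1) * k * 120"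
            by simp
        qed
      qed
    qed
  qed
qed

section \<open>From the abstract alphabet to the machine input\<close>

lemma encodes_encoding:
  assumes "encodes num x w" "w \<in> step_sequences \<Sigma> sim" "bij_betw num \<Sigma> {..<k}"
  obtains xss where "x = encoding xss" "map set xss = map ((`) num) w"
    "sum_list (map length xss) = occurrences w"
    "\<forall>xs\<in>set xss. distinct xs \<and> set xs \<subseteq> {..<k} \<and> xs \<noteq> []"
proof -
  obtain xss where enc: "list_all2 (encodes_step num) xss w" and x: "x = encoding xss"
    using assms(1) by (auto simp: encodes_def encoding_def)
  have "map set xss = map ((`) num) w \<and> sum_list (map length xss) = occurrences w \<and>
    (\<forall>xs\<in>set xss. distinct xs \<and> set xs \<subseteq> {..<k} \<and> xs \<noteq> [])"
    using enc assms(2)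
  proof (induction rule: list_all2_induct)
    case (Cons xs xss A w)
    have A: "A \<noteq> {}" "A \<subseteq> \<Sigma>" using Cons.prems by (auto simp: step_sequences_def steps_def)
    have xs: "distinct xs" "set xs = num ` A" using Cons.hyps by (auto simp: encodes_step_def)
    \<comment> \<open>Injectivity makes the written length of a step its cardinality, which turns
      list lengths in the time bound into action occurrences.\<close>
    have "inj_on num A" using assms(3) A(2) by (meson bij_betw_def inj_on_subset)
    then have "length xs = card A" using xs by (metis card_image distinct_card)
    moreover have "set xs \<subseteq> {..<k}" using xs(2) A(2) assms(3) by (auto simp: bij_betw_def)
    moreover have "xs \<noteq> []" using xs(2) A(1) by auto
    ultimately show ?case using Cons xs by (auto simp: step_sequences_def occurrences_def)
  qed (simp add: occurrences_def)
  with x show thesis by (intro that) auto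
qed

text \<open>Profiles are invariant under injective renaming, and as \<open>ser\<close> lies within
  \<open>\<Sigma> \<times> \<Sigma>\<close>, the renamed relation exempts exactly the renamed
  pairs.\<close>

lemma same_profiles_image:
  assumes "bij_betw num \<Sigma> {..<k}" "ser \<subseteq> \<Sigma> \<times> \<Sigma>"
    "w \<in> step_sequences \<Sigma> sim" "u \<in> step_sequences \<Sigma> sim"
  shows "same_profiles {..<k} (map_prod num num ` ser) (map ((`) num) w) (map ((`) num) u) \<longleftrightarrow>
    same_profiles \<Sigma> ser w u"
proof -
  have inj: "inj_on num \<Sigma>" and im: "{..<k} = num ` \<Sigma>"
    using assms(1) by (auto simp: bij_betw_def)
  have sub: "\<forall>A\<in>set w. A \<subseteq> \<Sigma>" "\<forall>A\<in>set u. A \<subseteq> \<Sigma>"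
    using assms(3,4) by (auto simp: step_sequences_def steps_def)
  have ser: "(num b, num a) \<in> map_prod num num ` ser \<longleftrightarrow> (b, a) \<in> ser"
    if "a \<in> \<Sigma>" "b \<in> \<Sigma>" for a b
    using inj_on_image_mem_iff[OF map_prod_inj_on[OF inj inj], of "(b, a)" ser] that assms(2)
    by simp
  show ?thesis
    unfolding same_profiles_def im
    by (simp add: profile_image[OF inj _ _ sub(1)] profile_image[OF inj _ _ sub(2)] ser)
qed

theorem theorem4p3:
  shows "\<exists>P. \<forall>c::nat. \<exists>C::nat. \<forall>(\<Sigma>::'a set) sim ser k num n w u x y.
    comtrace_alphabet \<Sigma> sim ser \<and> card \<Sigma> = k \<and> bij_betw num \<Sigma> {..<k} \<and>
    w \<in> step_sequences \<Sigma> sim \<and> u \<in> step_sequences \<Sigma> sim \<and>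
    1 \<le> n \<and> occurrences w + occurrences u \<le> c * n \<and>
    encodes num x w \<and> encodes num y u \<longrightarrow>
    decides_within P (input_state num k sim ser x y) (comtrace_equiv \<Sigma> sim ser w u) (C * (n * k))"
proof (rule exI[of _ decide_equiv], intro allI, rule_tac x = "120 * (c + 1)" in exI,
    intro allI impI, elim conjE)
  fix c k n :: nat and \<Sigma> :: "'a set" and sim ser num w u x y
  assume alph: "comtrace_alphabet \<Sigma> sim ser" and card: "card \<Sigma> = k"
    and num: "bij_betw num \<Sigma> {..<k}"
    and w: "w \<in> step_sequences \<Sigma> sim" and u: "u \<in> step_sequences \<Sigma> sim"
    and n: "1 \<le> n" "occurrences w + occurrences u \<le> c * n"
    and enc: "encodes num x w" "encodes num y u"
  interpret comtrace \<Sigma> sim ser by unfold_locales (rule alph)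
  let ?r = "map_prod num num ` ser" and ?s = "input_state num k sim ser x y"
  have k: "0 < k" using alph card by (auto simp: comtrace_alphabet_def card_gt_0_iff)
  have ser: "ser \<subseteq> \<Sigma> \<times> \<Sigma>" using alph by (auto simp: comtrace_alphabet_def)
  have irr: "\<forall>a<k. (a, a) \<notin> ?r"
  proof -
    have "num a \<noteq> num b" if "(a, b) \<in> ser" for a b
      using that num ser ser_sim[OF that] by (auto simp: bij_betw_def dest: inj_onD)
    then show ?thesis by auto
  qed
  obtain xss where xss: "x = encoding xss" "map set xss = map ((`) num) w"
    "sum_list (map length xss) = occurrences w"
    "\<forall>xs\<in>set xss. distinct xs \<and> set xs \<subseteq> {..<k} \<and> xs \<noteq> []"
    by (rule encodes_encoding[OF enc(1) w num])
  obtain yss where yss: "y = encoding yss" "map set yss = map ((`) num) u"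
    "sum_list (map length yss) = occurrences u"
    "\<forall>ys\<in>set yss. distinct ys \<and> set ys \<subseteq> {..<k} \<and> ys \<noteq> []"
    by (rule encodes_encoding[OF enc(2) u num])
  have "wp decide_equiv ?s (\<lambda>t s'.
    regs s' 0 = of_bool (same_profiles {..<k} ?r (map set xss) (map set yss)) \<and>
    t \<le> (sum_list (map length xss) + sum_list (map length yss) + 1) * k * 120)"
    by (rule wp_decide_equiv[OF k])
      (use irr xss(1,4) yss(1,4) in \<open>auto simp: input_state_def\<close>)
  moreover have "same_profiles {..<k} ?r (map set xss) (map set yss) \<longleftrightarrow>
    comtrace_equiv \<Sigma> sim ser w u"
    using same_profiles_image[OF num ser w u] equiv_iff_same_profiles[OF w u] xss(2) yss(2) by simp
  \<comment> \<open>The additive 1 is absorbed into one more \<open>n\<close> since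
    \<open>1 \<le> n\<close>, whence the factor \<open>c + 1\<close>.\<close>
  moreover have "(occurrences w + occurrences u + 1) * k * 120 \<le> 120 * (c + 1) * (n * k)"
  proof -
    have "occurrences w + occurrences u + 1 \<le> (c + 1) * n" using n by simp
    then have "(occurrences w + occurrences u + 1) * (k * 120) \<le> (c + 1) * n * (k * 120)"
      by (rule mult_le_mono1)
    then show ?thesis by (simp only: mult_ac)
  qed
  ultimately show "decides_within decide_equiv ?s (comtrace_equiv \<Sigma> sim ser w u)
      (120 * (c + 1) * (n * k))"
    unfolding decides_within_def wp_def using xss(3) yss(3) le_trans by fastforce
qed

end
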